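(* Let $m\ge 1$ and $3\le a_1\le a_2\le\cdots\le a_m<n$ be integers with $\sum_{i=1}^m a_i=n$. Then $$\eta(K_{a_1,a_2,\dots,a_m})=\begin{cases} 2n-a_1+3, & n-a_1 \text{ even},\\ 2n-a_1+2, & n-a_1 \text{ odd.}\end{cases}$$
   Context: $K_{a_1,\dots,a_m}$ denotes the complete multipartite graph with parts of sizes $a_1,\dots,a_m$. A configuration $C$ on a graph $G$ is a function $C:V(G)\to\mathbb{Z}_{\ge 0}$ ($C(v)$ is the number of pebbles on $v$); its size is $\sum_{v}C(v)$. A pebbling move removes two pebbles from a vertex and places one pebble on an adjacent vertex. The Two-Player Pebbling Game on $G$ with root $r$ and starting configuration $C$ is played by Mover and Defender in rounds: in each round Mover makes a pebbling move and then Defender makes a pebbling move; each player must take their turn. If Mover pebbles from $u$ to $v$, Defender may not pebble from $v$ to $u$ in the same round. Mover wins if at any time the root has at least one pebble; Defender wins if the root has no pebble and there are no more pebbling moves. A winning strategy for a player is a rule choosing that player's moves as a function of the current position which guarantees that player wins. The rooted two-player pebbling number $\eta(G,r)$ is the minimum $m$ such that for every configuration of $m$ pebbles Mover has a winning strategy; if for arbitrarily large $m$ there is a configuration of size greater than $m$ on which Defender has a winning strategy, then $\eta(G,r)=\infty$. The two-player pebbling number is $\eta(G)=\max_{r\in V(G)}\eta(G,r)$ (equal to $\infty$ if some $\eta(G,r)=\infty$). *)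

theory Defs
  imports "Graph_Theory.Pair_Digraph" "HOL-Library.Extended_Nat"
begin

(* Undirected simple graphs are the pair_graphs of Graph_Theory: finite, loop-free,
   with a symmetric arc relation parcs G, so that (u, v) : parcs G means that
   u and v are adjacent. *)

definition complete_multipartite :: "nat \<Rightarrow> (nat \<Rightarrow> nat) \<Rightarrow> (nat \<times> nat) pair_pre_digraph" where
  "complete_multipartite m a =
     \<lparr> pverts = (SIGMA i:{1..m}. {1..a i}),
       parcs = {(u, v). u \<in> (SIGMA i:{1..m}. {1..a i}) \<and>
                        v \<in> (SIGMA i:{1..m}. {1..a i}) \<and> fst u \<noteq> fst v} \<rparr>"

lemma pair_graph_complete_multipartite: "pair_graph (complete_multipartite m a)"
proof -
  let ?V = "SIGMA i:{1..m}. {1..a i}"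
  have fin: "finite ?V" by auto
  have "finite (parcs (complete_multipartite m a))"
    by (rule finite_subset[of _ "?V \<times> ?V"])
       (auto simp: complete_multipartite_def intro: fin)
  then show ?thesis
    using fin
    by unfold_locales (auto simp: complete_multipartite_def symmetric_def intro!: symI)
qed


type_synonym 'a config = "'a \<Rightarrow> nat"

(* HOL functions are total, so a configuration on G is taken to be 0 off the vertex set. *)
definition configs :: "'a pair_pre_digraph \<Rightarrow> 'a config set" where
  "configs G = {C. \<forall>v. v \<notin> pverts G \<longrightarrow> C v = 0}"

definition config_size :: "'a pair_pre_digraph \<Rightarrow> 'a config \<Rightarrow> nat" where
  "config_size G C = (\<Sum>v\<in>pverts G. C v)"

definition pebbling_moves :: "'a pair_pre_digraph \<Rightarrow> 'a config \<Rightarrow> ('a \<times> 'a) set" where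
  "pebbling_moves G C = {(u, v). (u, v) \<in> parcs G \<and> 2 \<le> C u}"

definition pebble :: "'a config \<Rightarrow> 'a \<times> 'a \<Rightarrow> 'a config" where
  "pebble C mv = (case mv of (u, v) \<Rightarrow> C(u := C u - 2, v := C v + 1))"


datatype player = Mover | Defender

(* When Defender is to move, the position also records the move that Mover has made in
   the current round, since it determines which moves are permitted. *)
datatype 'a position =
    Mover_To_Move "'a config"
  | Defender_To_Move "'a config" "'a \<times> 'a"

fun to_move :: "'a position \<Rightarrow> player" where
  "to_move (Mover_To_Move C) = Mover"
| "to_move (Defender_To_Move C mv) = Defender"

fun config_of :: "'a position \<Rightarrow> 'a config" where
  "config_of (Mover_To_Move C) = C"
| "config_of (Defender_To_Move C mv) = C"

fun legal_moves :: "'a pair_pre_digraph \<Rightarrow> 'a position \<Rightarrow> ('a \<times> 'a) set" where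
  "legal_moves G (Mover_To_Move C) = pebbling_moves G C"
| "legal_moves G (Defender_To_Move C (u, v)) = pebbling_moves G C - {(v, u)}"

fun make_move :: "'a position \<Rightarrow> 'a \<times> 'a \<Rightarrow> 'a position" where
  "make_move (Mover_To_Move C) mv = Defender_To_Move (pebble C mv) mv"
| "make_move (Defender_To_Move C mv') mv = Mover_To_Move (pebble C mv)"

(* The player to move having no legal move ends the game.  In a graph of minimum degree
   at least 2, Defender has a legal move whenever there is a pebbling move at all. *)
definition finished :: "'a pair_pre_digraph \<Rightarrow> 'a \<Rightarrow> 'a position \<Rightarrow> bool" where
  "finished G r p \<longleftrightarrow> 1 \<le> config_of p r \<or> legal_moves G p = {}"

(* The winner of a finished game. *)
definition winner :: "'a \<Rightarrow> 'a position \<Rightarrow> player" where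
  "winner r p = (if 1 \<le> config_of p r then Mover else Defender)"

type_synonym 'a strategy = "'a position \<Rightarrow> 'a \<times> 'a"

definition is_strategy :: "'a pair_pre_digraph \<Rightarrow> 'a \<Rightarrow> player \<Rightarrow> 'a strategy \<Rightarrow> bool" where
  "is_strategy G r P \<sigma> \<longleftrightarrow>
     (\<forall>p. to_move p = P \<and> \<not> finished G r p \<longrightarrow> \<sigma> p \<in> legal_moves G p)"

(* One step of a play in which P follows the strategy and the opponent moves freely. *)
definition play_step ::
  "'a pair_pre_digraph \<Rightarrow> 'a \<Rightarrow> player \<Rightarrow> 'a strategy \<Rightarrow> 'a position \<Rightarrow> 'a position \<Rightarrow> bool" where
  "play_step G r P \<sigma> p q \<longleftrightarrow>
     \<not> finished G r p \<and>
     (\<exists>mv\<in>legal_moves G p. q = make_move p mv \<and> (to_move p = P \<longrightarrow> mv = \<sigma> p))"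

(* Every move removes a pebble from the graph, so there are no infinite plays, and a
   strategy guarantees a win iff all finished plays following it are won. *)
definition winning_strategy ::
  "'a pair_pre_digraph \<Rightarrow> 'a \<Rightarrow> player \<Rightarrow> 'a config \<Rightarrow> 'a strategy \<Rightarrow> bool" where
  "winning_strategy G r P C \<sigma> \<longleftrightarrow>
     is_strategy G r P \<sigma> \<and>
     (\<forall>p. (play_step G r P \<sigma>)\<^sup>*\<^sup>* (Mover_To_Move C) p \<and> finished G r p \<longrightarrow> winner r p = P)"

definition has_winning_strategy ::
  "'a pair_pre_digraph \<Rightarrow> 'a \<Rightarrow> player \<Rightarrow> 'a config \<Rightarrow> bool" where
  "has_winning_strategy G r P C \<longleftrightarrow> (\<exists>\<sigma>. winning_strategy G r P C \<sigma>)"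


(* In the finite case the LEAST is over a nonempty set, because on a finite graph one of
   the two players always has a winning strategy. *)
definition rooted_two_player_pebbling_number :: "'a pair_pre_digraph \<Rightarrow> 'a \<Rightarrow> enat" where
  "rooted_two_player_pebbling_number G r =
     (if \<forall>m. \<exists>C\<in>configs G. m < config_size G C \<and> has_winning_strategy G r Defender C
      then \<infinity>
      else enat (LEAST m. \<forall>C\<in>configs G. config_size G C = m \<longrightarrow> has_winning_strategy G r Mover C))"

definition two_player_pebbling_number :: "'a pair_pre_digraph \<Rightarrow> enat" where
  "two_player_pebbling_number G = Max (rooted_two_player_pebbling_number G ` pverts G)"

end

theory Submission
  imports Defs
begin

text \<open>
  Let \<open>A\<close> be the part of the root \<open>r\<close> and \<open>B\<close> the set of all other vertices, which are exactly the
  neighbours of \<open>r\<close>. Mover wins at once if a vertex of \<open>B\<close> carries two pebbles, so suppose that none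
  does; then all moves start in \<open>A\<close>. Let \<open>s = (\<Sum>u\<in>A. C u div 2)\<close> and let \<open>z\<close> be the number of empty
  vertices of \<open>B\<close>. If Mover pebbles an empty vertex of \<open>B\<close>, then Defender has to pebble another one,
  and the round decreases \<open>s\<close> and \<open>z\<close> by \<open>2\<close>. If Mover pebbles an occupied vertex of \<open>B\<close>, then
  Defender has to clear it, and can do so by moving to a third vertex \<open>w\<close> of \<open>A\<close>, so that \<open>z\<close> grows
  by \<open>1\<close>, and \<open>s\<close> drops by \<open>1\<close> unless \<open>w\<close> had an odd number of pebbles. Mover wins if \<open>z = 1\<close> and
  \<open>s \<ge> 2\<close>, because then Defender has no empty vertex left. Hence Mover wins if \<open>z\<close> is odd and
  \<open>s \<ge> z + 1\<close>, or if \<open>z\<close> is even and \<open>s \<ge> z + 3\<close> (\<open>s \<ge> z + 2\<close> suffices if all piles on \<open>A - {r}\<close> are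
  odd); Defender wins if \<open>z\<close> is odd and \<open>s \<le> z\<close>, or if \<open>z\<close> is even and \<open>s \<le> z + 1\<close> (\<open>s \<le> z + 2\<close>
  suffices if some vertex of \<open>A - {r}\<close> is empty).
\<close>

section \<open>Won positions\<close>

text \<open>Backward induction on the game tree: a least fixed point allows induction on how a win
  is forced, with no strategy function to carry along.\<close>

inductive wins :: "'a pair_pre_digraph \<Rightarrow> 'a \<Rightarrow> player \<Rightarrow> 'a position \<Rightarrow> bool"
  for G r P where
  finished: "finished G r p \<Longrightarrow> winner r p = P \<Longrightarrow> wins G r P p"
| own: "\<not> finished G r p \<Longrightarrow> to_move p = P \<Longrightarrow> mv \<in> legal_moves G p \<Longrightarrow>
    wins G r P (make_move p mv) \<Longrightarrow> wins G r P p"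
| opponent: "\<not> finished G r p \<Longrightarrow> to_move p \<noteq> P \<Longrightarrow>
    (\<And>mv. mv \<in> legal_moves G p \<Longrightarrow> wins G r P (make_move p mv)) \<Longrightarrow> wins G r P p"

text \<open>Moving into a won position whenever one is in reach is a strategy, and all plays that
  follow it stay inside \<open>wins\<close>.\<close>

lemma wins_imp_has_winning_strategy:
  assumes "wins G r P (Mover_To_Move C)"
  shows "has_winning_strategy G r P C"
proof -
  \<comment> \<open>The default is an arbitrary legal move, because \<open>is_strategy\<close>
    demands legality in every unfinished position, won or not.\<close>
  define \<sigma> where "\<sigma> p = (if \<exists>mv\<in>legal_moves G p. wins G r P (make_move p mv)
      then SOME mv. mv \<in> legal_moves G p \<and> wins G r P (make_move p mv)
      else SOME mv. mv \<in> legal_moves G p)" for p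
  have good: "\<sigma> p \<in> legal_moves G p \<and> wins G r P (make_move p (\<sigma> p))"
    if "\<exists>mv\<in>legal_moves G p. wins G r P (make_move p mv)" for p
    using someI_ex[of "\<lambda>mv. mv \<in> legal_moves G p \<and> wins G r P (make_move p mv)"] that
    by (auto simp: \<sigma>_def)
  have "\<sigma> p \<in> legal_moves G p" if "\<not> finished G r p" for p
  proof (cases "\<exists>mv\<in>legal_moves G p. wins G r P (make_move p mv)")
    case True
    then show ?thesis using good by blast
  next
    case False
    have "\<exists>mv. mv \<in> legal_moves G p" using that by (auto simp: finished_def)
    from someI_ex[OF this] False show ?thesis by (simp add: \<sigma>_def)
  qed
  then have strat: "is_strategy G r P \<sigma>" by (simp add: is_strategy_def)
  have step: "wins G r P q" if "wins G r P p" "play_step G r P \<sigma> p q" for p q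
    using that(1)
  proof cases
    case finished
    then show ?thesis using that(2) by (simp add: play_step_def)
  next
    case (own mv)
    then show ?thesis using that(2) good[of p] by (auto simp: play_step_def)
  next
    case opponent
    then show ?thesis using that(2) by (auto simp: play_step_def)
  qed
  have "wins G r P p" if "(play_step G r P \<sigma>)\<^sup>*\<^sup>* (Mover_To_Move C) p" for p
    using that by (induction rule: rtranclp_induct) (auto intro: assms step)
  moreover have "winner r p = P" if "wins G r P p" "finished G r p" for p
    using that by (auto elim: wins.cases)
  ultimately show ?thesis
    using strat by (auto simp: has_winning_strategy_def winning_strategy_def)
qed

text \<open>By induction on \<open>wins\<close>, a play following a winning strategy of
  \<open>P\<close> never meets a position won for \<open>Q\<close>: it could go on to one with a
  shorter derivation, and finally to an end that \<open>Q\<close> wins.\<close>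

lemma wins_imp_not_has_winning_strategy:
  assumes "wins G r Q (Mover_To_Move C)" and "P \<noteq> Q"
  shows "\<not> has_winning_strategy G r P C"
proof
  assume "has_winning_strategy G r P C"
  then obtain \<sigma> where strat: "is_strategy G r P \<sigma>"
    and win: "\<And>p. (play_step G r P \<sigma>)\<^sup>*\<^sup>* (Mover_To_Move C) p \<Longrightarrow> finished G r p \<Longrightarrow> winner r p = P"
    by (auto simp: has_winning_strategy_def winning_strategy_def)
  have "\<not> (play_step G r P \<sigma>)\<^sup>*\<^sup>* (Mover_To_Move C) p" if "wins G r Q p" for p
    using that
  proof induction
    case (finished p)
    then show ?case using win assms(2) by blast
  next
    case (own p mv)
    then have "play_step G r P \<sigma> p (make_move p mv)"
      using assms(2) by (auto simp: play_step_def)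
    then show ?case using own.IH by (meson rtranclp.rtrancl_into_rtrancl)
  next
    case (opponent p)
    have "to_move p = P" using opponent(2) assms(2) by (metis player.exhaust)
    then have "\<sigma> p \<in> legal_moves G p" using strat opponent(1) by (simp add: is_strategy_def)
    then have "play_step G r P \<sigma> p (make_move p (\<sigma> p))"
      using opponent(1) by (auto simp: play_step_def)
    then show ?case using opponent.IH[OF \<open>\<sigma> p \<in> legal_moves G p\<close>]
      by (meson rtranclp.rtrancl_into_rtrancl)
  qed
  then show False using assms(1) by blast
qed

text \<open>Additions on both sides avoid truncated subtraction on \<open>nat\<close>.\<close>

lemma sum_fun_upd:
  fixes f :: "'b \<Rightarrow> nat"
  assumes "finite A" "u \<in> A"
  shows "(\<Sum>x\<in>A. f ((C(u := c)) x)) + f (C u) = (\<Sum>x\<in>A. f (C x)) + f c"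
proof -
  have "(\<Sum>x\<in>A. f ((C(u := c)) x)) = f c + (\<Sum>x\<in>A - {u}. f (C x))"
    by (subst sum.remove[OF assms]) (auto intro!: sum.cong)
  moreover have "(\<Sum>x\<in>A. f (C x)) = f (C u) + (\<Sum>x\<in>A - {u}. f (C x))"
    by (rule sum.remove[OF assms])
  ultimately show ?thesis by simp
qed

section \<open>The game around a root whose non-neighbours form an independent set\<close>

text \<open>The structure fixed is that \<open>A\<close> is independent and joined to
  \<open>B\<close>. Arcs inside \<open>B\<close> stay open, so that the other parts of a
  multipartite graph can be merged into \<open>B\<close>.\<close>

locale rooted_join =
  fixes G :: "'a pair_pre_digraph" and r :: 'a and A B :: "'a set"
  assumes finite_A: "finite A" and finite_B: "finite B" and disjoint: "A \<inter> B = {}"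
    and root: "r \<in> A" and B_nonempty: "B \<noteq> {}"
    and pverts_eq: "pverts G = A \<union> B"
    and arcs_A: "u \<in> A \<Longrightarrow> (u, v) \<in> parcs G \<longleftrightarrow> v \<in> B"
    and arcs_B: "u \<in> B \<Longrightarrow> v \<in> A \<Longrightarrow> (u, v) \<in> parcs G"
    and arcs_in: "parcs G \<subseteq> (A \<union> B) \<times> (A \<union> B)"
begin

definition s :: "'a config \<Rightarrow> nat" where
  "s C = (\<Sum>u\<in>A. C u div 2)"

definition z :: "'a config \<Rightarrow> nat" where
  "z C = (\<Sum>v\<in>B. of_bool (C v = 0))"

text \<open>The positions with Mover to move in which Mover has not won and cannot pebble the root
  at once.\<close>

definition quiet :: "'a config \<Rightarrow> bool" where
  "quiet C \<longleftrightarrow> C r = 0 \<and> (\<forall>v\<in>B. C v \<le> 1)"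

lemma s_upd: "u \<in> A \<Longrightarrow> s (C(u := c)) + C u div 2 = s C + c div 2"
  unfolding s_def by (rule sum_fun_upd[OF finite_A])

lemma s_upd_B: "v \<in> B \<Longrightarrow> s (C(v := c)) = s C"
  unfolding s_def using disjoint by (intro sum.cong) auto

lemma z_upd: "v \<in> B \<Longrightarrow> z (C(v := c)) + of_bool (C v = 0) = z C + of_bool (c = 0)"
  unfolding z_def by (rule sum_fun_upd[OF finite_B, where f = "\<lambda>n. of_bool (n = 0)"])

lemma z_upd_A: "u \<in> A \<Longrightarrow> z (C(u := c)) = z C"
  unfolding z_def using disjoint by (intro sum.cong) auto

lemma s_pos: "0 < s C \<Longrightarrow> \<exists>u\<in>A. 2 \<le> C u"
  unfolding s_def by (rule ccontr) (auto simp: not_le)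

lemma z_pos: "0 < z C \<Longrightarrow> \<exists>v\<in>B. C v = 0"
  unfolding z_def by (rule ccontr) (simp add: sum.neutral)

lemma s_eq_0: "s C = 0 \<Longrightarrow> u \<in> A \<Longrightarrow> C u \<le> 1"
  unfolding s_def using finite_A by (auto simp: not_le)

lemma z_eq_0: "z C = 0 \<Longrightarrow> v \<in> B \<Longrightarrow> C v \<noteq> 0"
  unfolding z_def using finite_B by auto

section \<open>Mover's strategy\<close>

lemma wins_loud:
  assumes "\<not> quiet C"
  shows "wins G r Mover (Mover_To_Move C)"
proof (cases "1 \<le> C r")
  case True
  then show ?thesis by (auto intro!: wins.finished simp: finished_def winner_def)
next
  case False
  then obtain v where v: "v \<in> B" "2 \<le> C v" using assms by (auto simp: quiet_def not_le)
  have "v \<noteq> r" using v root disjoint by auto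
  have legal: "(v, r) \<in> legal_moves G (Mover_To_Move C)"
    using v root arcs_B by (auto simp: pebbling_moves_def)
  have "wins G r Mover (make_move (Mover_To_Move C) (v, r))"
    using \<open>v \<noteq> r\<close> by (intro wins.finished) (auto simp: finished_def winner_def pebble_def)
  moreover have "\<not> finished G r (Mover_To_Move C)"
    using legal False by (auto simp: finished_def)
  ultimately show ?thesis using legal by - (rule wins.own[where mv = "(v, r)"], auto)
qed

text \<open>One round, reduced to its quiet outcomes, as \<open>wins_loud\<close> settles the
  others. Defender must have a reply: being stuck with the root empty is a win for Defender.\<close>

lemma wins_by_move:
  assumes "quiet C" "u \<in> A" "v \<in> B" "2 \<le> C u"
    and "legal_moves G (Defender_To_Move (pebble C (u, v)) (u, v)) \<noteq> {}"
    and "\<And>x y. (x, y) \<in> legal_moves G (Defender_To_Move (pebble C (u, v)) (u, v)) \<Longrightarrow>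
      quiet (pebble (pebble C (u, v)) (x, y)) \<Longrightarrow>
      wins G r Mover (Mover_To_Move (pebble (pebble C (u, v)) (x, y)))"
  shows "wins G r Mover (Mover_To_Move C)"
proof -
  have "u \<noteq> v" "v \<noteq> r" "u \<noteq> r" using assms root disjoint by (auto simp: quiet_def)
  have 1: "\<not> finished G r (Defender_To_Move (pebble C (u, v)) (u, v))"
    using assms \<open>v \<noteq> r\<close> \<open>u \<noteq> r\<close> by (auto simp: finished_def pebble_def quiet_def)
  have legal: "(u, v) \<in> legal_moves G (Mover_To_Move C)"
    using assms arcs_A by (auto simp: pebbling_moves_def)
  have "wins G r Mover (Defender_To_Move (pebble C (u, v)) (u, v))"
    using 1
  proof (rule wins.opponent)
    fix mv assume mv: "mv \<in> legal_moves G (Defender_To_Move (pebble C (u, v)) (u, v))"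
    obtain x y where xy: "mv = (x, y)" by fastforce
    show "wins G r Mover (make_move (Defender_To_Move (pebble C (u, v)) (u, v)) mv)"
      using assms(6)[of x y] mv wins_loud unfolding xy by (simp only: make_move.simps) blast
  qed simp
  moreover have "\<not> finished G r (Mover_To_Move C)"
    using legal assms(1) by (auto simp: finished_def quiet_def)
  ultimately show ?thesis using legal by - (rule wins.own[where mv = "(u, v)"], auto)
qed

text \<open>With at most one pebble on each vertex of \<open>B\<close>, Defender has to move from
  \<open>A\<close> to \<open>B\<close>, and only an empty target keeps the position quiet. If
  \<open>z C = 1\<close>, no such target is left, so \<open>fill\<close> is vacuous and Mover wins.
  Piles on \<open>A\<close> only lose pairs, which keeps their parity.\<close>

lemma wins_by_fill:
  assumes "quiet C" "1 \<le> z C" "2 \<le> s C"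
    and fill: "\<And>D. quiet D \<Longrightarrow> z D + 2 = z C \<Longrightarrow> s D + 2 = s C \<Longrightarrow>
      (\<forall>w\<in>A. even (D w) \<longleftrightarrow> even (C w)) \<Longrightarrow> wins G r Mover (Mover_To_Move D)"
  shows "wins G r Mover (Mover_To_Move C)"
proof -
  obtain u where u: "u \<in> A" "2 \<le> C u" using s_pos[of C] assms by auto
  obtain v where v: "v \<in> B" "C v = 0" using z_pos[of C] assms by auto
  define E where "E = pebble C (u, v)"
  have "u \<noteq> v" using u v disjoint by auto
  have E: "E = C(u := C u - 2, v := 1)" using \<open>u \<noteq> v\<close> v by (simp add: E_def pebble_def)
  have sE: "s E + 1 = s C"
    using s_upd[OF u(1), of C "C u - 2"] u(2) v(1) by (simp add: E s_upd_B)
  have zE: "z E + 1 = z C"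
    using z_upd[OF v(1), of "C(u := C u - 2)" 1] u v \<open>u \<noteq> v\<close> by (simp add: E z_upd_A)
  have EB: "E x \<le> 1" if "x \<in> B" for x
    using assms(1) that u disjoint by (auto simp: E quiet_def)
  have Er: "E r = 0" using assms(1) u v root disjoint by (auto simp: E quiet_def)
  obtain u' where u': "u' \<in> A" "2 \<le> E u'" using s_pos[of E] sE assms by auto
  show ?thesis
  proof (rule wins_by_move[OF assms(1) u(1) v(1) u(2)], fold E_def)
    have "(u', v) \<in> legal_moves G (Defender_To_Move E (u, v))"
      using u' v arcs_A disjoint by (auto simp: pebbling_moves_def)
    then show "legal_moves G (Defender_To_Move E (u, v)) \<noteq> {}" by blast
  next
    fix x y assume xy: "(x, y) \<in> legal_moves G (Defender_To_Move E (u, v))"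
      and q: "quiet (pebble E (x, y))"
    have x: "x \<in> A" "2 \<le> E x" using xy arcs_in EB[of x] by (auto simp: pebbling_moves_def)
    have y: "y \<in> B" using xy x arcs_A by (auto simp: pebbling_moves_def)
    have "x \<noteq> y" using x y disjoint by auto
    have Ey: "E y = 0" using q y by (auto simp: quiet_def pebble_def)
    define D where "D = pebble E (x, y)"
    have D: "D = E(x := E x - 2, y := 1)" using \<open>x \<noteq> y\<close> Ey by (simp add: D_def pebble_def)
    have "s D + 1 = s E"
      using s_upd[OF x(1), of E "E x - 2"] x(2) y by (simp add: D s_upd_B)
    moreover have "z D + 1 = z E"
      using z_upd[OF y(1), of "E(x := E x - 2)" 1] x y Ey \<open>x \<noteq> y\<close> by (simp add: D z_upd_A)
    moreover have "\<forall>w\<in>A. even (D w) \<longleftrightarrow> even (C w)"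
      using x y u v disjoint by (auto simp: D E)
    ultimately show "wins G r Mover (Mover_To_Move (pebble E (x, y)))"
      using fill[of D] q sE zE unfolding D_def by auto
  qed
qed

text \<open>Filling rounds keep \<open>s - z\<close> fixed and lead down to \<open>z = 1\<close>,
  where the premise of \<open>wins_by_fill\<close> is vacuous.\<close>

lemma wins_odd:
  assumes "quiet C" "odd (z C)" "z C + 1 \<le> s C"
  shows "wins G r Mover (Mover_To_Move C)"
  using assms
proof (induction "z C" arbitrary: C rule: less_induct)
  case less
  have "0 < z C" using less.prems(2) by (rule odd_pos)
  show ?case
  proof (rule wins_by_fill)
    fix D assume "quiet D" "z D + 2 = z C" "s D + 2 = s C"
    moreover from this have "odd (z D)" using less.prems(2) by (simp flip: \<open>z D + 2 = z C\<close>)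
    ultimately show "wins G r Mover (Mover_To_Move D)" using less by simp
  qed (use less.prems \<open>0 < z C\<close> in auto)
qed

text \<open>Mover doubles a pebble on the full set \<open>B\<close>. Defender must clear that
  vertex, but not into \<open>B\<close> (creating a pair there), not to \<open>r\<close>, and not
  back to \<open>u\<close>. A target \<open>y\<close> in \<open>A\<close> leaves
  \<open>z = 1\<close>, so \<open>wins_odd\<close> asks for \<open>2 \<le> s D\<close>; the pebble
  arriving at \<open>y\<close> restores the lost unit of \<open>s\<close> exactly if
  \<open>C y\<close> was odd.\<close>

lemma wins_full:
  assumes "quiet C" "z C = 0"
    and "3 \<le> s C \<or> 2 \<le> s C \<and> (\<forall>w\<in>A - {r}. odd (C w))"
  shows "wins G r Mover (Mover_To_Move C)"
proof -
  obtain u where u: "u \<in> A" "2 \<le> C u" using s_pos[of C] assms by auto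
  obtain v where v: "v \<in> B" using B_nonempty by blast
  have full: "C x = 1" if "x \<in> B" for x
    using z_eq_0[OF assms(2) that] assms(1) that by (auto simp: quiet_def le_Suc_eq)
  define E where "E = pebble C (u, v)"
  have "u \<noteq> v" using u v disjoint by auto
  have "u \<noteq> r" using u assms by (auto simp: quiet_def)
  have E: "E = C(u := C u - 2, v := 2)" using \<open>u \<noteq> v\<close> full[OF v] by (simp add: E_def pebble_def numeral_2_eq_2)
  have sE: "s E + 1 = s C"
    using s_upd[OF u(1), of C "C u - 2"] u(2) v by (simp add: E s_upd_B)
  show ?thesis
  proof (rule wins_by_move[OF assms(1) u(1) v u(2)], fold E_def)
    \<comment> \<open>This reply pebbles the root, but it shows that Defender is not stuck.\<close>
    have "(v, r) \<in> legal_moves G (Defender_To_Move E (u, v))"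
      using v root arcs_B \<open>u \<noteq> r\<close> by (auto simp: pebbling_moves_def E)
    then show "legal_moves G (Defender_To_Move E (u, v)) \<noteq> {}" by blast
  next
    fix x y assume xy: "(x, y) \<in> legal_moves G (Defender_To_Move E (u, v))"
      and q: "quiet (pebble E (x, y))"
    have "x = v"
    proof (rule ccontr)
      assume "x \<noteq> v"
      then have "2 \<le> pebble E (x, y) v" by (simp add: pebble_def E)
      then show False using q v by (auto simp: quiet_def)
    qed
    have "y \<notin> B"
    proof
      assume "y \<in> B"
      then have "1 \<le> E y" using full[of y] u disjoint by (auto simp: E)
      then have "2 \<le> pebble E (x, y) y" by (simp add: pebble_def)
      then show False using q \<open>y \<in> B\<close> by (auto simp: quiet_def)
    qed
    then have y: "y \<in> A" using xy arcs_in by (auto simp: pebbling_moves_def)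
    have "y \<noteq> r" using q by (auto simp: quiet_def pebble_def)
    have "y \<noteq> u" using xy \<open>x = v\<close> by auto
    define D where "D = pebble E (x, y)"
    have D: "D = E(v := 0, y := C y + 1)"
      using \<open>x = v\<close> \<open>y \<notin> B\<close> \<open>y \<noteq> u\<close> v by (auto simp: D_def pebble_def E)
    have zD: "z D = 1"
      using z_upd[OF v, of E 0] z_upd[OF v, of "C(u := C u - 2)" 2] full[OF v] u y assms(2)
        \<open>u \<noteq> v\<close> by (simp add: D E z_upd_A)
    have "y \<noteq> v" using v \<open>y \<notin> B\<close> by blast
    have "E y = C y" using \<open>y \<notin> B\<close> \<open>y \<noteq> u\<close> v by (auto simp: E)
    then have sD: "s D + C y div 2 = s E + (C y + 1) div 2"
      using s_upd[OF y, of "E(v := 0)" "C y + 1"] v \<open>y \<noteq> v\<close> by (simp add: D s_upd_B)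
    have "2 \<le> s D"
      using assms(3)
    proof
      assume "3 \<le> s C"
      moreover have "C y div 2 \<le> (C y + 1) div 2" by simp
      ultimately show ?thesis using sD sE by linarith
    next
      assume "2 \<le> s C \<and> (\<forall>w\<in>A - {r}. odd (C w))"
      moreover from this have "odd (C y)" using y \<open>y \<noteq> r\<close> by blast
      then have "(C y + 1) div 2 = C y div 2 + 1" by presburger
      ultimately show ?thesis using sD sE by linarith
    qed
    then show "wins G r Mover (Mover_To_Move (pebble E (x, y)))"
      using wins_odd[of D] q zD unfolding D_def by simp
  qed
qed

text \<open>Filling rounds keep \<open>s - z\<close> and the parities on \<open>A\<close>, so they
  reduce to \<open>wins_full\<close>.\<close>

lemma wins_even:
  assumes "quiet C" "even (z C)"
    and "z C + 3 \<le> s C \<or> z C + 2 \<le> s C \<and> (\<forall>w\<in>A - {r}. odd (C w))"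
  shows "wins G r Mover (Mover_To_Move C)"
  using assms
proof (induction "z C" arbitrary: C rule: less_induct)
  case less
  show ?case
  proof (cases "z C = 0")
    case True
    then show ?thesis using less.prems by (intro wins_full) (simp_all add: numeral_2_eq_2)
  next
    case False
    show ?thesis
    proof (rule wins_by_fill)
      fix D assume D: "quiet D" "z D + 2 = z C" "s D + 2 = s C"
        "\<forall>w\<in>A. even (D w) \<longleftrightarrow> even (C w)"
      have "even (z D)" using less.prems(2) by (simp flip: D(2))
      moreover have "z D + 3 \<le> s D \<or> z D + 2 \<le> s D \<and> (\<forall>w\<in>A - {r}. odd (D w))"
        using less.prems(3) D by auto
      ultimately show "wins G r Mover (Mover_To_Move D)" using less.hyps D by simp
    qed (use less.prems False in auto)
  qed
qed

section \<open>Defender's strategy\<close>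

text \<open>On quiet positions this complements the conditions of \<open>wins_odd\<close> and
  \<open>wins_even\<close>, except for even \<open>z\<close> and \<open>s = z + 2\<close> when some
  pile on \<open>A - {r}\<close> is even but none is empty. Emptiness is asked for because an empty
  vertex, unlike a positive even pile, is never the one Mover moves from, to which the return is
  barred.\<close>

definition defended :: "'a config \<Rightarrow> bool" where
  "defended C \<longleftrightarrow> quiet C \<and>
    (if odd (z C) then s C \<le> z C
     else s C \<le> z C + 1 \<or> s C \<le> z C + 2 \<and> (\<exists>x\<in>A - {r}. C x = 0))"

lemma wins_reply:
  assumes "E r = 0" "legal_moves G (Defender_To_Move E mv) \<noteq> {} \<Longrightarrow>
    \<exists>mv'\<in>legal_moves G (Defender_To_Move E mv).
      wins G r Defender (Mover_To_Move (pebble E mv'))"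
  shows "wins G r Defender (Defender_To_Move E mv)"
proof (cases "legal_moves G (Defender_To_Move E mv) = {}")
  case True
  then show ?thesis using assms(1) by (intro wins.finished) (auto simp: finished_def winner_def)
next
  case False
  with assms(2) obtain mv' where "mv' \<in> legal_moves G (Defender_To_Move E mv)"
    "wins G r Defender (Mover_To_Move (pebble E mv'))" by blast
  then show ?thesis using False assms(1)
    by - (rule wins.own[where mv = mv'], auto simp: finished_def)
qed

text \<open>Whenever Defender can move, some reply restores \<open>defended\<close>. The induction
  is on the pebbles in \<open>A\<close>: \<open>s\<close> may stay equal and \<open>z\<close> may
  grow, but Mover takes two pebbles out of \<open>A\<close> and Defender returns at most
  one.\<close>

lemma wins_defended:
  assumes "3 \<le> card A" "defended C"
  shows "wins G r Defender (Mover_To_Move C)"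
  using assms(2)
proof (induction "sum C A" arbitrary: C rule: less_induct)
  case less
  note IH = less.hyps
  have q: "quiet C" using less.prems by (simp add: defended_def)
  show ?case
  proof (cases "legal_moves G (Mover_To_Move C) = {}")
    case True
    then show ?thesis using q
      by (intro wins.finished) (auto simp: finished_def winner_def quiet_def)
  next
    case False
    then have "\<not> finished G r (Mover_To_Move C)" using q by (simp add: finished_def quiet_def)
    then show ?thesis
    proof (rule wins.opponent)
      fix mv assume mv: "mv \<in> legal_moves G (Mover_To_Move C)"
      obtain u v where uv: "mv = (u, v)" by fastforce
      have u: "u \<in> A" "2 \<le> C u"
        using mv arcs_in q by (fastforce simp: uv pebbling_moves_def quiet_def)+
      have v: "v \<in> B" using mv u arcs_A by (auto simp: uv pebbling_moves_def)
      have "u \<noteq> v" using u v disjoint by auto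
      define E where "E = pebble C (u, v)"
      have E: "E = C(u := C u - 2, v := C v + 1)"
        using \<open>u \<noteq> v\<close> by (simp add: E_def pebble_def)
      have sE: "s E + 1 = s C"
        using s_upd[OF u(1), of C "C u - 2"] u(2) v by (simp add: E s_upd_B)
      have SE: "sum E A + 2 = sum C A"
      proof -
        have "sum E A = sum (C(u := C u - 2)) A"
          using v disjoint by (intro sum.cong) (auto simp: E)
        then show ?thesis
          using sum_fun_upd[OF finite_A u(1), of "\<lambda>n. n" C "C u - 2"] u(2) by simp
      qed
      have Er: "E r = 0" using q u v root disjoint by (auto simp: E quiet_def)
      have "wins G r Defender (Defender_To_Move E (u, v))"
      proof (cases "C v = 0")
        case True
        have zE: "z E + 1 = z C"
          using z_upd[OF v(1), of "C(u := C u - 2)" 1] u v \<open>u \<noteq> v\<close> True by (simp add: E z_upd_A)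
        have EB: "E x \<le> 1" if "x \<in> B" for x
          using q that u disjoint True by (auto simp: E quiet_def)
        show ?thesis
        proof (rule wins_reply[where E = E and mv = "(u, v)", OF Er])
          assume "legal_moves G (Defender_To_Move E (u, v)) \<noteq> {}"
          then obtain x y where xy: "(x, y) \<in> legal_moves G (Defender_To_Move E (u, v))" by auto
          have x: "x \<in> A" "2 \<le> E x" using xy arcs_in EB[of x] by (auto simp: pebbling_moves_def)
          \<comment> \<open>If no empty vertex of \<open>B\<close> were left, then
            \<open>z C = 1\<close>, so \<open>defended\<close> would give \<open>s C \<le> 1\<close>
            and hence \<open>s E = 0\<close>.\<close>
          have "s E \<noteq> 0" using s_eq_0[of E x] x by auto
          then have "0 < z E"
            using less.prems sE zE by (cases "z E = 0") (auto simp: defended_def split: if_splits)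
          then obtain w where w: "w \<in> B" "E w = 0" using z_pos by blast
          have "x \<noteq> w" using x w disjoint by auto
          have legal: "(x, w) \<in> legal_moves G (Defender_To_Move E (u, v))"
            using x w v arcs_A disjoint by (auto simp: pebbling_moves_def)
          define D where "D = pebble E (x, w)"
          have D: "D = E(x := E x - 2, w := 1)" using \<open>x \<noteq> w\<close> w by (simp add: D_def pebble_def)
          have sD: "s D + 1 = s E"
            using s_upd[OF x(1), of E "E x - 2"] x(2) w by (simp add: D s_upd_B)
          have zD: "z D + 1 = z E"
            using z_upd[OF w(1), of "E(x := E x - 2)" 1] x w \<open>x \<noteq> w\<close> by (simp add: D z_upd_A)
          have "quiet D" using EB Er w x root disjoint by (auto simp: quiet_def D)
          \<comment> \<open>Empty vertices of \<open>A\<close> stay empty, so the clause of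
            \<open>defended\<close> about an empty \<open>x\<close> survives the round.\<close>
          moreover have "D t = 0" if "t \<in> A" "C t = 0" for t
            using that u v x w disjoint by (auto simp: D E)
          moreover have "z D + 2 = z C" "s D + 2 = s C" using sD zD sE zE by auto
          moreover from this have "odd (z D) \<longleftrightarrow> odd (z C)" by (simp flip: \<open>z D + 2 = z C\<close>)
          ultimately have "defended D"
            using less.prems by (auto simp: defended_def split: if_splits)
          moreover have "sum D A < sum C A"
          proof -
            have "sum D A \<le> sum E A"
              using w disjoint by (intro sum_mono) (auto simp: D)
            then show ?thesis using SE by simp
          qed
          ultimately show "\<exists>mv'\<in>legal_moves G (Defender_To_Move E (u, v)).
              wins G r Defender (Mover_To_Move (pebble E mv'))"
            using IH[of D] legal D_def by blast
        qed
      next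
        case False
        then have Cv: "C v = 1" using q v by (auto simp: quiet_def le_Suc_eq)
        \<comment> \<open>Defender clears \<open>v\<close> towards \<open>w\<close>, which must
          avoid the root and the barred \<open>u\<close>; an empty \<open>w\<close> is preferred. An
          empty vertex differs from \<open>u\<close>, and without one \<open>3 \<le> card A\<close>
          supplies \<open>w\<close>.\<close>
        have "\<exists>w\<in>A - {r, u}. (\<exists>x\<in>A - {r}. C x = 0) \<longrightarrow> C w = 0"
        proof (cases "\<exists>x\<in>A - {r}. C x = 0")
          case True
          then obtain x where "x \<in> A - {r}" "C x = 0" by blast
          moreover from this have "x \<noteq> u" using u(2) by auto
          ultimately show ?thesis by blast
        next
          case False
          have "card {r, u} < card A" using assms(1) by (simp add: card_insert_if)
          then have "\<not> A \<subseteq> {r, u}" using card_mono[of "{r, u}" A] by auto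
          then show ?thesis using False by blast
        qed
        then obtain w where w: "w \<in> A" "w \<noteq> r" "w \<noteq> u"
          and w0: "\<exists>x\<in>A - {r}. C x = 0 \<Longrightarrow> C w = 0" by blast
        have "w \<noteq> v" using w v disjoint by auto
        have legal: "(v, w) \<in> legal_moves G (Defender_To_Move E (u, v))"
          using v w arcs_B Cv by (auto simp: pebbling_moves_def E)
        define D where "D = pebble E (v, w)"
        have D: "D = E(v := 0, w := C w + 1)"
          using \<open>w \<noteq> v\<close> w Cv by (auto simp: D_def pebble_def E)
        have zD: "z D = z C + 1"
          using z_upd[OF v, of E 0] z_upd[OF v, of "C(u := C u - 2)" "C v + 1"] Cv u w
            \<open>u \<noteq> v\<close> by (simp add: D E z_upd_A)
        have Ew: "E w = C w" using \<open>w \<noteq> v\<close> w by (simp add: E)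
        then have sD: "s D + C w div 2 = s E + (C w + 1) div 2"
          using s_upd[OF w(1), of "E(v := 0)" "C w + 1"] v \<open>w \<noteq> v\<close> by (simp add: D s_upd_B)
        have "quiet D"
          using q v w u root disjoint by (auto simp: quiet_def D E)
        have "s D \<le> s C"
        proof -
          have "(C w + 1) div 2 \<le> C w div 2 + 1" by simp
          then show ?thesis using sD sE by linarith
        qed
        \<comment> \<open>A pebble on an empty \<open>w\<close> adds nothing to \<open>s\<close>, so
          the round costs a full unit; this makes \<open>s C = z C + 2\<close> tolerable.\<close>
        have s_drop: "(\<exists>x\<in>A - {r}. C x = 0) \<longrightarrow> s D + 1 = s C"
        proof
          assume "\<exists>x\<in>A - {r}. C x = 0"
          then have "C w = 0" by (rule w0)
          then show "s D + 1 = s C" using sD sE by simp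
        qed
        have "defended D"
        proof (cases "odd (z C)")
          case True
          then have "s C \<le> z C" using less.prems by (simp add: defended_def)
          then show ?thesis using True \<open>quiet D\<close> \<open>s D \<le> s C\<close> zD by (simp add: defended_def)
        next
          case False
          then have "s C \<le> z C + 1 \<or> s C \<le> z C + 2 \<and> (\<exists>x\<in>A - {r}. C x = 0)"
            using less.prems by (simp add: defended_def)
          then have "s D \<le> z D" using \<open>s D \<le> s C\<close> s_drop zD by linarith
          then show ?thesis using False \<open>quiet D\<close> zD by (simp add: defended_def)
        qed
        moreover have "sum D A < sum C A"
        proof -
          have "sum D A = sum (E(w := C w + 1)) A"
            using v disjoint by (intro sum.cong) (auto simp: D)
          then show ?thesis
            using sum_fun_upd[OF finite_A w(1), of "\<lambda>n. n" E "C w + 1"] SE Ew by simp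
        qed
        ultimately show ?thesis
          using IH[of D] legal D_def by (intro wins_reply[where E = E and mv = "(u, v)", OF Er]) blast
      qed
      then show "wins G r Defender (make_move (Mover_To_Move C) mv)"
        by (simp add: uv E_def)
    qed simp
  qed
qed

section \<open>From \<open>s\<close> and \<open>z\<close> to the number of pebbles\<close>

text \<open>With \<open>n = card A + card B\<close> the values are \<open>2 * n - card A + 3\<close>
  and \<open>2 * n - card A + 2\<close>.\<close>

definition threshold :: nat where
  "threshold = (if even (card B) then 2 * card B + card A + 3 else 2 * card B + card A + 2)"

lemma config_size_eq: "config_size G C = sum C A + sum C B"
  unfolding config_size_def pverts_eq by (rule sum.union_disjoint[OF finite_A finite_B disjoint])

lemma sum_B_add_z:
  assumes "quiet C"
  shows "sum C B + z C = card B"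
proof -
  have "sum C B + z C = (\<Sum>v\<in>B. C v + of_bool (C v = 0))" by (simp add: z_def sum.distrib)
  also have "\<dots> = (\<Sum>v\<in>B. 1)"
    using assms by (intro sum.cong) (auto simp: quiet_def le_Suc_eq)
  finally show ?thesis by simp
qed

text \<open>If \<open>d\<close> piles on \<open>A - {r}\<close> are odd, a quiet \<open>C\<close>
  has size \<open>2 * s C + d + card B - z C\<close>. Here \<open>d \<le> card A - 1\<close>, with
  equality only if all these piles are odd, the case in which \<open>wins_even\<close> asks for
  less.\<close>

lemma wins_threshold:
  assumes "threshold \<le> config_size G C"
  shows "wins G r Mover (Mover_To_Move C)"
proof (cases "quiet C")
  case False
  then show ?thesis by (rule wins_loud)
next
  case True
  define d where "d = (\<Sum>u\<in>A - {r}. C u mod 2)"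
  have "sum C A = sum C (A - {r})"
    using True root finite_A by (subst sum.remove[of A r]) (auto simp: quiet_def)
  also have "\<dots> = (\<Sum>u\<in>A - {r}. 2 * (C u div 2) + C u mod 2)" by (intro sum.cong) auto
  also have "\<dots> = 2 * (\<Sum>u\<in>A - {r}. C u div 2) + d"
    by (simp only: sum.distrib sum_distrib_left d_def)
  also have "(\<Sum>u\<in>A - {r}. C u div 2) = s C"
    unfolding s_def using True root finite_A by (subst sum.remove[of A r]) (auto simp: quiet_def)
  finally have SA: "sum C A = 2 * s C + d" .
  have A1: "card (A - {r}) + 1 = card A"
    using root finite_A card_Suc_Diff1[of A r] by simp
  have d_le: "d + 1 \<le> card A"
  proof -
    have "d \<le> (\<Sum>u\<in>A - {r}. 1)" unfolding d_def by (intro sum_mono) auto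
    then show ?thesis using A1 by simp
  qed
  have d_eq: "\<forall>w\<in>A - {r}. odd (C w)" if "d + 1 = card A"
  proof (rule ccontr)
    assume "\<not> ?thesis"
    then obtain w where w: "w \<in> A - {r}" "even (C w)" by blast
    have "d < (\<Sum>u\<in>A - {r}. 1)"
      unfolding d_def using w finite_A by (intro sum_strict_mono_ex1) (auto simp: even_iff_mod_2_eq_zero)
    then show False using A1 that by simp
  qed
  have size: "threshold \<le> 2 * s C + d + sum C B"
    using assms SA by (simp add: config_size_eq)
  have thr: "2 * card B + card A + 2 \<le> threshold" by (simp add: threshold_def)
  note sz = sum_B_add_z[OF True]
  show ?thesis
  proof (cases "odd (z C)")
    case odd: True
    have "z C + 1 \<le> s C" using size sz d_le thr by linarith
    then show ?thesis using wins_odd True odd by blast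
  next
    case even: False
    have "z C + 2 \<le> s C" using size sz d_le thr by linarith
    moreover have "z C + 3 \<le> s C" if "d + 1 \<noteq> card A"
    \<comment> \<open>The last unit towards \<open>2 * z C + 5 \<le> 2 * s C\<close> comes from an
      occupied vertex of \<open>B\<close>, or, if there is none, from the larger threshold, since
      \<open>card B = z C\<close> is even.\<close>
    proof (cases "card B = z C")
      case True
      then have "threshold = 2 * card B + card A + 3" using even by (simp add: threshold_def)
      then show ?thesis using size sz d_le that by linarith
    next
      case False
      then show ?thesis using size sz d_le thr that by linarith
    qed
    ultimately have "z C + 3 \<le> s C \<or> z C + 2 \<le> s C \<and> d + 1 = card A" by blast
    then show ?thesis using wins_even True even d_eq by blast
  qed
qed

text \<open>Extremal positions: \<open>y\<close> has \<open>2 * z + 5\<close> pebbles, every other pile on \<open>A\<close> has at most one,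
  \<open>x\<close> is empty, and one pebble on \<open>B\<close> makes \<open>z\<close> even if \<open>card B\<close> is odd.\<close>

lemma exists_defended:
  assumes "3 \<le> card A" "M < threshold"
  shows "\<exists>C\<in>configs G. config_size G C = M \<and> defended C"
proof -
  have "1 < card (A - {r})" using assms(1) root finite_A by simp
  then obtain x where x: "x \<in> A - {r}" by (metis card.empty ex_in_conv not_one_less_zero)
  have "0 < card (A - {r} - {x})" using \<open>1 < card (A - {r})\<close> x finite_A by simp
  then obtain y where y: "y \<in> A - {r} - {x}" by (metis card.empty ex_in_conv less_irrefl)
  obtain v where v: "v \<in> B" using B_nonempty by blast
  \<comment> \<open>For \<open>M = 0\<close> there is no pebble to put on \<open>v\<close>; that
    case is defended because \<open>s C = 0\<close>.\<close>
  define k :: nat where "k = (if odd (card B) \<and> 0 < M then 1 else 0)"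
  \<comment> \<open>With \<open>z C = card B - k\<close>, the cap is the largest pile whose half is
    at most \<open>z C + 2\<close>.\<close>
  define c where "c = min (M - k) (2 * (card B - k) + 5)"
  have k: "k \<le> card B" "k \<le> 1" by (auto simp: k_def odd_pos Suc_le_eq)
  have "card (A - {r, x, y}) = card A - 3"
    using x y root finite_A by (subst card_Diff_subset) auto
  \<comment> \<open>Equality holds at \<open>M = threshold - 1\<close>, for either parity of
    \<open>card B\<close>.\<close>
  moreover have "M - k - c \<le> card A - 3"
    using assms k unfolding c_def k_def threshold_def by (auto split: if_splits)
  ultimately obtain S where S: "S \<subseteq> A - {r, x, y}" "card S = M - k - c" "finite S"
    using obtain_subset_with_card_n[of "M - k - c" "A - {r, x, y}"] by auto
  define C where "C t = (if t = y then c else if t = v then k else of_bool (t \<in> S))" for t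
  have "y \<noteq> v" "v \<notin> A" using y v disjoint by auto
  have q: "quiet C" using x y S v k root disjoint by (auto simp: quiet_def C_def)
  have C_A: "C t = of_bool (t \<in> S)" if "t \<in> A - {y}" for t
    using that \<open>v \<notin> A\<close> by (auto simp: C_def)
  have sumA: "(\<Sum>t\<in>A. f (C t)) = f c + (\<Sum>t\<in>A - {y}. f (of_bool (t \<in> S)))"
    for f :: "nat \<Rightarrow> nat"
    using y finite_A C_A by (subst sum.remove[of A y]) (auto simp: C_def[of y] intro!: sum.cong)
  have "s C = c div 2"
    unfolding s_def by (subst sumA[of "\<lambda>n. n div 2"]) (auto intro!: sum.neutral)
  have "(\<Sum>t\<in>A - {y}. of_bool (t \<in> S)) = card ((A - {y}) \<inter> S)"
    using finite_A by (simp add: of_bool_def sum.If_cases Int_def)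
  also have "(A - {y}) \<inter> S = S" using S by auto
  finally have SA: "sum C A = c + (M - k - c)" using sumA[of "\<lambda>n. n"] S by simp
  have "sum C B = k + sum C (B - {v})"
    using v finite_B \<open>y \<noteq> v\<close> by (subst sum.remove[of B v]) (auto simp: C_def)
  also have "sum C (B - {v}) = 0"
    using y S disjoint by (intro sum.neutral) (auto simp: C_def)
  finally have SB: "sum C B = k" by simp
  have "k \<le> M" by (simp add: k_def)
  then have "config_size G C = M" using SA SB by (simp add: config_size_eq c_def)
  moreover have "C \<in> configs G"
    using x y v S by (auto simp: configs_def pverts_eq C_def)
  moreover have "defended C"
  proof -
    have zC: "z C = card B - k" using sum_B_add_z[OF q] SB by simp
    have "C x = 0" using x y S v \<open>v \<notin> A\<close> by (auto simp: C_def)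
    show ?thesis
    proof (cases "M = 0")
      case True
      then have "s C = 0" using \<open>s C = c div 2\<close> by (simp add: c_def)
      then show ?thesis using q by (simp add: defended_def)
    next
      case False
      then have "even (z C)" using zC by (auto simp: k_def)
      moreover have "s C \<le> z C + 2"
      proof -
        have "c \<le> 2 * z C + 5" using zC by (simp add: c_def)
        then show ?thesis using \<open>s C = c div 2\<close> by linarith
      qed
      ultimately show ?thesis using q x \<open>C x = 0\<close> by (auto simp: defended_def)
    qed
  qed
  ultimately show ?thesis by blast
qed

lemma rooted_number_le: "rooted_two_player_pebbling_number G r \<le> enat threshold"
proof -
  have "\<not> (\<forall>m. \<exists>C\<in>configs G. m < config_size G C \<and> has_winning_strategy G r Defender C)"
    using wins_imp_not_has_winning_strategy[OF wins_threshold]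
    by (meson less_imp_le_nat player.distinct(2))
  moreover have "(LEAST m. \<forall>C\<in>configs G. config_size G C = m \<longrightarrow>
      has_winning_strategy G r Mover C) \<le> threshold"
    by (rule Least_le) (simp add: wins_imp_has_winning_strategy wins_threshold)
  ultimately show ?thesis by (simp add: rooted_two_player_pebbling_number_def)
qed

text \<open>A priori the \<open>LEAST\<close> could be any size below \<open>threshold\<close>,
  which is why \<open>exists_defended\<close> provides a configuration of each such size.\<close>

lemma rooted_number_ge:
  assumes "3 \<le> card A"
  shows "enat threshold \<le> rooted_two_player_pebbling_number G r"
proof -
  have "threshold \<le> (LEAST m. \<forall>C\<in>configs G. config_size G C = m \<longrightarrow>
      has_winning_strategy G r Mover C)" (is "_ \<le> Least ?P")
  proof (rule ccontr)
    assume "\<not> ?thesis"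
    then obtain C where C: "C \<in> configs G" "config_size G C = Least ?P" "defended C"
      using exists_defended[OF assms] by (meson not_le)
    have "?P threshold" by (simp add: wins_imp_has_winning_strategy wins_threshold)
    then have "?P (Least ?P)" by (rule LeastI)
    then have "has_winning_strategy G r Mover C" using C by blast
    then show False
      using wins_imp_not_has_winning_strategy[OF wins_defended[OF assms C(3)]] by blast
  qed
  then show ?thesis by (simp add: rooted_two_player_pebbling_number_def)
qed

end

section \<open>Complete multipartite graphs\<close>

lemma rooted_join_complete_multipartite:
  fixes a :: "nat \<Rightarrow> nat"
  assumes "i \<in> {1..m}" "j \<in> {1..a i}" "a i < (\<Sum>i=1..m. a i)"
  shows "rooted_join (complete_multipartite m a) (i, j) ({i} \<times> {1..a i})
      (SIGMA l:{1..m} - {i}. {1..a l})"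
    and "card (SIGMA l:{1..m} - {i}. {1..a l}) = (\<Sum>i=1..m. a i) - a i"
proof -
  let ?B = "SIGMA l:{1..m} - {i}. {1..a l}"
  have "card ?B = (\<Sum>l\<in>{1..m} - {i}. a l)" by simp
  also have "\<dots> = (\<Sum>i=1..m. a i) - a i"
    using assms(1) by (subst sum_diff1_nat) auto
  finally show card: "card ?B = (\<Sum>i=1..m. a i) - a i" .
  then have "?B \<noteq> {}" using assms(3) by (metis card.empty less_irrefl zero_less_diff)
  then show "rooted_join (complete_multipartite m a) (i, j) ({i} \<times> {1..a i}) ?B"
    using assms(1,2) by unfold_locales (auto simp: complete_multipartite_def)
qed

theorem theorem3p22:
  fixes m n :: nat and a :: "nat \<Rightarrow> nat"
  assumes "1 \<le> m"
    and "3 \<le> a 1"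
    and "\<forall>i\<in>{1..<m}. a i \<le> a (Suc i)"
    and "a m < n"
    and "(\<Sum>i=1..m. a i) = n"
  shows "two_player_pebbling_number (complete_multipartite m a) =
           enat (if even (n - a 1) then 2 * n - a 1 + 3 else 2 * n - a 1 + 2)"
proof -
  let ?G = "complete_multipartite m a"
  define F :: "nat \<Rightarrow> nat" where
    "F b = (if even (n - b) then 2 * (n - b) + b + 3 else 2 * (n - b) + b + 2)" for b
  have mono: "a i \<le> a j" if "1 \<le> i" "i \<le> j" "j \<le> m" for i j
    using that(2,3,1)
  proof (induction rule: dec_induct)
    case (step l)
    then show ?case using assms(3) by (metis Suc_leD Suc_le_eq atLeastLessThan_iff le_trans)
  qed simp
  have lt: "a i < n" if "i \<in> {1..m}" for i
    using mono[of i m] that assms(4) by auto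
  have join: "rooted_join ?G (i, j) ({i} \<times> {1..a i}) (SIGMA l:{1..m} - {i}. {1..a l})"
    and thr: "rooted_join.threshold ({i} \<times> {1..a i}) (SIGMA l:{1..m} - {i}. {1..a l}) = F (a i)"
    if "i \<in> {1..m}" "j \<in> {1..a i}" for i j
  proof -
    show join: "rooted_join ?G (i, j) ({i} \<times> {1..a i}) (SIGMA l:{1..m} - {i}. {1..a l})"
      using rooted_join_complete_multipartite(1)[of i m j a] that lt[of i] assms(5) by simp
    show "rooted_join.threshold ({i} \<times> {1..a i}) (SIGMA l:{1..m} - {i}. {1..a l}) = F (a i)"
      using rooted_join_complete_multipartite(2)[of i m j a] that lt[of i] assms(5)
      by (simp only: rooted_join.threshold_def[OF join] F_def card_cartesian_product) simp
  qed
  have verts: "pverts ?G = (SIGMA i:{1..m}. {1..a i})" by (simp add: complete_multipartite_def)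
  have "two_player_pebbling_number ?G = enat (F (a 1))"
    unfolding two_player_pebbling_number_def
  proof (rule Max_eqI)
    show "finite (rooted_two_player_pebbling_number ?G ` pverts ?G)" by (simp add: verts)
  next
    fix e assume "e \<in> rooted_two_player_pebbling_number ?G ` pverts ?G"
    then obtain i j where ij: "i \<in> {1..m}" "j \<in> {1..a i}"
      and e: "e = rooted_two_player_pebbling_number ?G (i, j)" by (auto simp: verts)
    have "e \<le> enat (F (a i))"
      using rooted_join.rooted_number_le[OF join[OF ij]] thr[OF ij] e by simp
    \<comment> \<open>A larger root part lowers \<open>2 * n - b\<close> by at least one, while the
      parity term rises by at most one.\<close>
    also have "F (a i) \<le> F (a 1)"
    proof (cases "a i = a 1")
      case False
      then have "a 1 < a i" using mono[of 1 i] ij by auto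
      then show ?thesis using lt[OF ij(1)] by (auto simp: F_def)
    qed simp
    finally show "e \<le> enat (F (a 1))" by simp
  next
    have 1: "1 \<in> {1..m}" "1 \<in> {1..a 1}" using assms by auto
    \<comment> \<open>The maximum is attained at a root in a smallest part, where
      \<open>3 \<le> a 1\<close> gives the three vertices that Defender needs.\<close>
    have "rooted_two_player_pebbling_number ?G (1, 1) = enat (F (a 1))"
      using rooted_join.rooted_number_le[OF join[OF 1]]
        rooted_join.rooted_number_ge[OF join[OF 1]] thr[OF 1] assms(2)
      by (simp add: card_cartesian_product)
    moreover have "(1, 1) \<in> pverts ?G" using 1 by (simp add: verts)
    ultimately show "enat (F (a 1)) \<in> rooted_two_player_pebbling_number ?G ` pverts ?G"
      by (metis imageI)
  qed
  moreover have "a 1 < n" using lt[of 1] assms(1) by simp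
  ultimately show ?thesis by (auto simp: F_def)
qed

end
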